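(* Let $I,J,K\ge 2$ and let $\mathcal{Z}\in\mathbb{R}^{I\times J\times K}$ have rank larger than $2$. Let $\mathcal{X}$ be a locally best approximation of $\mathcal{Z}$ from $\overline{S}_2(I,J,K)$, with $\mathrm{rank}(\mathcal{X})=2$. Then the following statements hold. (i) $\mathcal{X}$ is a stationary point of the best rank-$(2,2,2)$ approximation problem for $\mathcal{Z}$, i.e. of $\min_{\mathcal{Y}\in M_{(2,2,2)}(I,J,K)}\|\mathcal{Z}-\mathcal{Y}\|_F^2$. (ii) If $\mathcal{X}$ is an interior point of $S_2(I,J,K)$, then $\mathcal{X}$ is a local minimizer in the best rank-$(2,2,2)$ approximation problem for $\mathcal{Z}$.
   Context: All tensors are real order-3 arrays and $\|\cdot\|_F$ is the Frobenius norm. The rank of $\mathcal{Y}\in\mathbb{R}^{I\times J\times K}$ is the least $R$ such that $\mathcal{Y}$ is a sum of $R$ outer products $\mathbf{a}_r\circ\mathbf{b}_r\circ\mathbf{c}_r$ (entries $a_ib_jc_k$) of real vectors. $S_R(I,J,K)$ is the set of $\mathcal{Y}\in\mathbb{R}^{I\times J\times K}$ with rank at most $R$, and $\overline{S}_R(I,J,K)$ is its closure in $\mathbb{R}^{I\times J\times K}$. The multilinear rank $\mathrm{mrank}(\mathcal{Y})$ is the triple of dimensions of the spans of the mode-1, mode-2 and mode-3 fibers of $\mathcal{Y}$ (vectors obtained by varying one index and fixing the other two). $M_{(R_1,R_2,R_3)}(I,J,K)$ is the set of $\mathcal{Y}$ with $\mathrm{mrank}(\mathcal{Y})\le(R_1,R_2,R_3)$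 componentwise. For matrices, $\mathcal{Y}=(\mathbf{S},\mathbf{T},\mathbf{U})\cdot\mathcal{G}$ means $y_{ijk}=\sum_{p,q,r}s_{ip}t_{jq}u_{kr}g_{pqr}$. A matrix is columnwise orthogonal if its columns are orthonormal. A locally best approximation of $\mathcal{Z}$ from a set $W$ is a local minimizer over $W$ of $\mathcal{Y}\mapsto\|\mathcal{Z}-\mathcal{Y}\|_F^2$; a local minimizer of the best rank-$(2,2,2)$ approximation problem is one over $W=M_{(2,2,2)}(I,J,K)$. Stationary point of the best rank-$(2,2,2)$ approximation problem for $\mathcal{Z}$: a tensor $\mathcal{X}$ for which there are orthogonal $\widetilde{\mathbf{S}}\in\mathbb{R}^{I\times I}$, $\widetilde{\mathbf{T}}\in\mathbb{R}^{J\times J}$, $\widetilde{\mathbf{U}}\in\mathbb{R}^{K\times K}$, whose first two columns form $\mathbf{S},\mathbf{T},\mathbf{U}$ respectively, such that $\mathcal{X}=(\mathbf{S},\mathbf{T},\mathbf{U})\cdot\mathcal{G}$ with $\mathcal{G}=(\mathbf{S}^T,\mathbf{T}^T,\mathbf{U}^T)\cdot\mathcal{Z}$ and such that $\widetilde{\mathcal{Z}}=(\widetilde{\mathbf{S}}^T,\widetilde{\mathbf{T}}^T,\widetilde{\mathbf{U}}^T)\cdot\mathcal{Z}$ (with entries $\tilde z_{ijk}$) satisfies the first-order conditions $$\sum_{q,r=1}^{2}\tilde z_{pqr}\tilde z_{iqr}=0\ (p\le 2<i\le I),\quad \sum_{p,r=1}^{2}\tilde z_{pqr}\tilde z_{pjr}=0\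 (q\le 2<j\le J),\quad \sum_{p,q=1}^{2}\tilde z_{pqr}\tilde z_{pqk}=0\ (r\le 2<k\le K).$$ Interior points: every $\mathcal{X}\in M_{(2,2,2)}(I,J,K)$ can be written $\mathcal{X}=(\mathbf{S},\mathbf{T},\mathbf{U})\cdot\mathcal{H}$ with columnwise orthogonal $\mathbf{S}\in\mathbb{R}^{I\times 2}$, $\mathbf{T}\in\mathbb{R}^{J\times 2}$, $\mathbf{U}\in\mathbb{R}^{K\times 2}$ and $\mathcal{H}\in\mathbb{R}^{2\times2\times2}$. Such $\mathcal{X}$ is called an interior point of $S_2(I,J,K)$ if $\mathcal{H}$ is a (topological) interior point of $S_2(2,2,2)$ in $\mathbb{R}^{2\times 2\times 2}$. *)

theory Defs
  imports "HOL-Analysis.Analysis"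
begin

text \<open>
  An \<open>I \<times> J \<times> K\<close> tensor has entries \<open>Y $ i $ j $ k\<close>, the dimensions being the cardinalities of
  the index types. The library norm of this type is the Frobenius norm (\<open>norm_tensor\<close> below), and
  its topology is the Euclidean one. An \<open>m \<times> n\<close> matrix has type \<open>real ^ 'n ^ 'm\<close>.
\<close>

type_synonym ('i, 'j, 'k) tensor = "real ^ 'k ^ 'j ^ 'i"

lemma norm_tensor:
  fixes Y :: "('i::finite, 'j::finite, 'k::finite) tensor"
  shows "norm Y = sqrt (\<Sum>i\<in>UNIV. \<Sum>j\<in>UNIV. \<Sum>k\<in>UNIV. (Y $ i $ j $ k)\<^sup>2)"
  by (simp add: norm_vec_def L2_set_def sum_nonneg)

definition outer :: "real ^ 'i \<Rightarrow> real ^ 'j \<Rightarrow> real ^ 'k \<Rightarrow> ('i, 'j, 'k) tensor" where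
  "outer a b c = (\<chi> i j k. a $ i * b $ j * c $ k)"

definition tensor_rank :: "('i::finite, 'j::finite, 'k::finite) tensor \<Rightarrow> nat" where
  "tensor_rank Y = (LEAST R. \<exists>a b c. Y = (\<Sum>r<R. outer (a r) (b r) (c r)))"

lemma tensor_rank_decomposition:
  fixes Y :: "('i::finite, 'j::finite, 'k::finite) tensor"
  shows "\<exists>a b c. Y = (\<Sum>r<tensor_rank Y. outer (a r) (b r) (c r))"
proof -
  let ?D = "UNIV :: ('i \<times> 'j \<times> 'k) set"
  obtain h where h: "bij_betw h {..<card ?D} ?D"
    using ex_bij_betw_nat_finite[of ?D] by (auto simp: atLeast0LessThan)
  let ?a = "\<lambda>(i, j, k). axis i (Y $ i $ j $ k)"
  let ?b = "\<lambda>(i::'i, j, k::'k). axis j (1::real)"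
  let ?c = "\<lambda>(i::'i, j::'j, k). axis k (1::real)"
  have "(\<Sum>d\<in>?D. outer (?a d) (?b d) (?c d)) = Y"
  proof -
    have "(\<Sum>d\<in>?D. outer (?a d) (?b d) (?c d) $ i $ j $ k) = Y $ i $ j $ k" for i j k
    proof -
      have "(\<Sum>d\<in>?D. outer (?a d) (?b d) (?c d) $ i $ j $ k)
          = (\<Sum>d\<in>?D. if d = (i, j, k) then Y $ i $ j $ k else 0)"
        by (rule sum.cong) (auto simp: outer_def axis_def split: if_splits)
      then show ?thesis by simp
    qed
    then show ?thesis by (simp add: vec_eq_iff)
  qed
  then have "Y = (\<Sum>r<card ?D. outer (?a (h r)) (?b (h r)) (?c (h r)))"
    using sum.reindex_bij_betw[OF h, of "\<lambda>d. outer (?a d) (?b d) (?c d)"] by simp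
  then have "\<exists>a b c. Y = (\<Sum>r<card ?D. outer (a r) (b r) (c r))"
    by (intro exI[of _ "\<lambda>r. ?a (h r)"] exI[of _ "\<lambda>r. ?b (h r)"] exI[of _ "\<lambda>r. ?c (h r)"])
  then show ?thesis
    unfolding tensor_rank_def by (rule LeastI)
qed

definition rank_le_set :: "nat \<Rightarrow> ('i::finite, 'j::finite, 'k::finite) tensor set" where
  "rank_le_set R = {Y. tensor_rank Y \<le> R}"

definition fibers1 :: "('i::finite, 'j::finite, 'k::finite) tensor \<Rightarrow> (real ^ 'i) set" where
  "fibers1 Y = {v. \<exists>j k. v = (\<chi> i. Y $ i $ j $ k)}"

definition fibers2 :: "('i::finite, 'j::finite, 'k::finite) tensor \<Rightarrow> (real ^ 'j) set" where
  "fibers2 Y = {v. \<exists>i k. v = (\<chi> j. Y $ i $ j $ k)}"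

definition fibers3 :: "('i::finite, 'j::finite, 'k::finite) tensor \<Rightarrow> (real ^ 'k) set" where
  "fibers3 Y = {v. \<exists>i j. v = (\<chi> k. Y $ i $ j $ k)}"

definition mrank :: "('i::finite, 'j::finite, 'k::finite) tensor \<Rightarrow> nat \<times> nat \<times> nat" where
  "mrank Y = (dim (span (fibers1 Y)), dim (span (fibers2 Y)), dim (span (fibers3 Y)))"

definition mrank_le_set ::
    "nat \<times> nat \<times> nat \<Rightarrow> ('i::finite, 'j::finite, 'k::finite) tensor set" where
  "mrank_le_set = (\<lambda>(R1, R2, R3).
     {Y. case mrank Y of (m1, m2, m3) \<Rightarrow> m1 \<le> R1 \<and> m2 \<le> R2 \<and> m3 \<le> R3})"

definition multilinear ::
    "real ^ 'p ^ 'i \<Rightarrow> real ^ 'q ^ 'j \<Rightarrow> real ^ 'r ^ 'k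
      \<Rightarrow> ('p::finite, 'q::finite, 'r::finite) tensor
      \<Rightarrow> ('i::finite, 'j::finite, 'k::finite) tensor" where
  "multilinear S T U G =
     (\<chi> i j k. \<Sum>p\<in>UNIV. \<Sum>q\<in>UNIV. \<Sum>r\<in>UNIV. S $ i $ p * T $ j $ q * U $ k $ r * G $ p $ q $ r)"

definition columnwise_orthogonal :: "real ^ 'n::finite ^ 'm::finite \<Rightarrow> bool" where
  "columnwise_orthogonal S \<longleftrightarrow>
     (\<forall>p q. column p S \<bullet> column q S = (if p = q then 1 else 0))"

definition local_minimizer :: "('a::topological_space \<Rightarrow> real) \<Rightarrow> 'a set \<Rightarrow> 'a \<Rightarrow> bool" where
  "local_minimizer f W x \<longleftrightarrow> x \<in> W \<and> (\<forall>\<^sub>F y in at x within W. f x \<le> f y)"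

definition locally_best_approximation ::
    "('i::finite, 'j::finite, 'k::finite) tensor \<Rightarrow> ('i, 'j, 'k) tensor set
      \<Rightarrow> ('i, 'j, 'k) tensor \<Rightarrow> bool" where
  "locally_best_approximation Z W X \<longleftrightarrow> local_minimizer (\<lambda>Y. (norm (Z - Y))\<^sup>2) W X"

text \<open>
  The two smallest indices. The elements of type \<open>2\<close> are \<open>0\<close> and \<open>1\<close>, and \<open>0 < 1\<close>.
  If the index type has a single element, the value at \<open>1\<close> is unspecified.
\<close>

definition lead :: "2 \<Rightarrow> 'i::{finite, linorder}" where
  "lead p = (if p = 0 then Min UNIV else Min (UNIV - {Min UNIV}))"

lemma lead_initial:
  assumes "CARD('i::{finite, linorder}) \<ge> 2"
  shows "lead 0 < (lead 1 :: 'i)" and "i \<notin> range lead \<Longrightarrow> lead 1 < (i :: 'i)"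
proof -
  let ?m = "Min UNIV :: 'i"
  have ne: "UNIV - {?m} \<noteq> {}"
  proof
    assume "UNIV - {?m} = {}"
    then have "(UNIV :: 'i set) = {?m}" by blast
    then have "CARD('i) = card {?m}" by (rule arg_cong)
    then show False using assms by simp
  qed
  have "Min (UNIV - {?m}) \<in> UNIV - {?m}"
    using ne by (intro Min_in) auto
  moreover have "?m \<le> Min (UNIV - {?m})" by simp
  ultimately have "?m < Min (UNIV - {?m})" by (simp add: order.not_eq_order_implies_strict)
  then show "lead 0 < (lead 1 :: 'i)" by (simp add: lead_def)
  assume i: "i \<notin> range lead"
  have "i \<noteq> lead 0" "i \<noteq> lead 1" using i by blast+
  then have "i \<in> UNIV - {?m}" "i \<noteq> Min (UNIV - {?m})" by (simp_all add: lead_def)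
  then show "lead 1 < i" by (simp add: lead_def order.not_eq_order_implies_strict)
qed

definition first_two_columns ::
    "real ^ 'i::{finite, linorder} ^ 'm::finite \<Rightarrow> real ^ 2 ^ 'm" where
  "first_two_columns S = (\<chi> i p. S $ i $ lead p)"

text \<open>
  Below, \<open>range lead\<close> is the set of the first two indices, so \<open>p \<in> range lead\<close> stands for
  \<open>p \<le> 2\<close> and \<open>i \<notin> range lead\<close> for \<open>2 < i\<close>.
\<close>

definition stationary_point_222 ::
    "('i::{finite, linorder}, 'j::{finite, linorder}, 'k::{finite, linorder}) tensor
      \<Rightarrow> ('i, 'j, 'k) tensor \<Rightarrow> bool" where
  "stationary_point_222 Z X \<longleftrightarrow>
     (\<exists>S' T' U'.
        orthogonal_matrix S' \<and> orthogonal_matrix T' \<and> orthogonal_matrix U' \<and>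
        (let S = first_two_columns S'; T = first_two_columns T'; U = first_two_columns U';
             G = multilinear (transpose S) (transpose T) (transpose U) Z;
             Z' = multilinear (transpose S') (transpose T') (transpose U') Z
         in X = multilinear S T U G \<and>
            (\<forall>p\<in>range lead. \<forall>i. i \<notin> range lead \<longrightarrow>
               (\<Sum>q\<in>range lead. \<Sum>r\<in>range lead. Z' $ p $ q $ r * Z' $ i $ q $ r) = 0) \<and>
            (\<forall>q\<in>range lead. \<forall>j. j \<notin> range lead \<longrightarrow>
               (\<Sum>p\<in>range lead. \<Sum>r\<in>range lead. Z' $ p $ q $ r * Z' $ p $ j $ r) = 0) \<and>
            (\<forall>r\<in>range lead. \<forall>k. k \<notin> range lead \<longrightarrow>
               (\<Sum>p\<in>range lead. \<Sum>q\<in>range lead. Z' $ p $ q $ r * Z' $ p $ q $ k) = 0)))"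

text \<open>
  This is not membership in \<open>interior (rank_le_set 2)\<close>: the topological interior is taken for the
  \<open>2 \<times> 2 \<times> 2\<close> core tensor.
\<close>

definition interior_point_rank2 :: "('i::finite, 'j::finite, 'k::finite) tensor \<Rightarrow> bool" where
  "interior_point_rank2 X \<longleftrightarrow>
     (\<exists>(S :: real ^ 2 ^ 'i) (T :: real ^ 2 ^ 'j) (U :: real ^ 2 ^ 'k) (H :: (2, 2, 2) tensor).
        columnwise_orthogonal S \<and> columnwise_orthogonal T \<and> columnwise_orthogonal U \<and>
        X = multilinear S T U H \<and> H \<in> interior (rank_le_set 2))"

end

theory Submission
  imports Defs
begin

text \<open>
  (i) Moving one factor of a two-term decomposition of \<open>X\<close> stays inside rank two, so the residual
  \<open>Z - X\<close> is orthogonal to every outer product that agrees with a term of the decomposition in two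
  factors. Any mixed product of factors of \<open>X\<close> has this form, by the pigeonhole principle if the
  factors are independent in every mode, and by changing the decomposition otherwise. Hence \<open>X\<close> is
  the projection of \<open>Z\<close> on the tensor product of planes containing the factors.

  (ii) The hyperdeterminant is nonnegative on \<open>2 \<times> 2 \<times> 2\<close> tensors of rank at most two, which forces
  an interior core to have independent factors in every mode. Then a tensor \<open>Y\<close> of multilinear rank
  at most \<open>(2, 2, 2)\<close> near \<open>X\<close> is recovered from its compression to the column spaces of \<open>X\<close>, and
  this compression is close to the interior core, so \<open>Y\<close> has rank at most two.
\<close>

section \<open>Outer products and multilinear transformations\<close>

lemma outer_nth [simp]: "outer a b c $ i $ j $ k = a $ i * b $ j * c $ k"
  by (simp add: outer_def)

lemma tensor_eq_iff: "X = Y \<longleftrightarrow> (\<forall>i j k. X $ i $ j $ k = Y $ i $ j $ k)"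
  by (simp add: vec_eq_iff)

lemma outer_add1: "outer (x + y) b c = outer x b c + outer y b c"
  and outer_add2: "outer a (x + y) c = outer a x c + outer a y c"
  and outer_add3: "outer a b (x + y) = outer a b x + outer a b y"
  by (simp_all add: tensor_eq_iff algebra_simps)

lemma outer_scaleR1: "outer (t *\<^sub>R x) b c = t *\<^sub>R outer x b c"
  and outer_scaleR2: "outer a (t *\<^sub>R x) c = t *\<^sub>R outer a x c"
  and outer_scaleR3: "outer a b (t *\<^sub>R x) = t *\<^sub>R outer a b x"
  by (simp_all add: tensor_eq_iff algebra_simps)

lemma outer_zero1 [simp]: "outer 0 b c = 0"
  and outer_zero2 [simp]: "outer a 0 c = 0"
  and outer_zero3 [simp]: "outer a b 0 = 0"
  by (simp_all add: tensor_eq_iff)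

lemma outer_sum2: "outer a (sum f Q) c = (\<Sum>q\<in>Q. outer a (f q) c)"
  by (induction Q rule: infinite_finite_induct) (simp_all add: outer_add2)

lemma outer_sum3: "outer a b (sum f Q) = (\<Sum>q\<in>Q. outer a b (f q))"
  by (induction Q rule: infinite_finite_induct) (simp_all add: outer_add3)

lemmas outer_linear = outer_add1 outer_add2 outer_add3 outer_scaleR1 outer_scaleR2 outer_scaleR3

lemma inner_tensor:
  fixes X Y :: "('i::finite, 'j::finite, 'k::finite) tensor"
  shows "X \<bullet> Y = (\<Sum>i\<in>UNIV. \<Sum>j\<in>UNIV. \<Sum>k\<in>UNIV. X $ i $ j $ k * Y $ i $ j $ k)"
  by (simp add: inner_vec_def)

lemma sum_product3:
  fixes f g h :: "_ \<Rightarrow> 'a::comm_semiring_0"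
  shows "sum f A * sum g B * sum h C = (\<Sum>i\<in>A. \<Sum>j\<in>B. \<Sum>k\<in>C. f i * g j * h k)"
  by (simp add: mult.assoc flip: sum_distrib_left sum_distrib_right)

lemma inner_outer_outer: "outer a b c \<bullet> outer x y z = (a \<bullet> x) * (b \<bullet> y) * (c \<bullet> z)"
proof -
  have "(a \<bullet> x) * (b \<bullet> y) * (c \<bullet> z)
      = (\<Sum>i\<in>UNIV. \<Sum>j\<in>UNIV. \<Sum>k\<in>UNIV. (a $ i * x $ i) * (b $ j * y $ j) * (c $ k * z $ k))"
    by (simp add: inner_vec_def sum_product3)
  then show ?thesis
    by (simp add: inner_tensor mult_ac)
qed

lemma linear_multilinear: "linear (multilinear S T U)"
  by (rule linearI)
    (simp_all add: tensor_eq_iff multilinear_def algebra_simps sum.distrib sum_distrib_left)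

lemma multilinear_outer:
  "multilinear S T U (outer a b c) = outer (S *v a) (T *v b) (U *v c)"
proof -
  have "multilinear S T U (outer a b c) $ i $ j $ k
      = (S *v a) $ i * (T *v b) $ j * (U *v c) $ k" for i j k
  proof -
    have "(S *v a) $ i * (T *v b) $ j * (U *v c) $ k = (\<Sum>p\<in>UNIV. \<Sum>q\<in>UNIV. \<Sum>r\<in>UNIV.
        (S $ i $ p * a $ p) * (T $ j $ q * b $ q) * (U $ k $ r * c $ r))"
      by (simp add: matrix_vector_mult_def sum_product3)
    then show ?thesis
      by (simp add: multilinear_def mult_ac)
  qed
  then show ?thesis by (simp add: tensor_eq_iff)
qed

text \<open>Outer products span the tensor space additively: scalars are absorbed into a factor and
  \<open>outer 0 0 0\<close> supplies the empty sum. Identities between linear maps thus need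
  checking only on outer products.\<close>

lemma tensor_induct [case_names outer add]:
  fixes Y :: "('i::finite, 'j::finite, 'k::finite) tensor"
  assumes "\<And>a b c. P (outer a b c)" and "\<And>X Y. P X \<Longrightarrow> P Y \<Longrightarrow> P (X + Y)"
  shows "P Y"
proof -
  obtain a b c where "Y = (\<Sum>r<tensor_rank Y. outer (a r) (b r) (c r))"
    using tensor_rank_decomposition by blast
  moreover have "P (\<Sum>r<n. outer (a r) (b r) (c r))" for n :: nat
  proof (induction n)
    case 0
    show ?case using assms(1)[of 0] by simp
  next
    case (Suc n)
    then show ?case using assms by simp
  qed
  ultimately show ?thesis by metis
qed

lemma multilinear_multilinear:
  "multilinear A B C (multilinear S T U Y) = multilinear (A ** S) (B ** T) (C ** U) Y"
  by (induction Y rule: tensor_induct)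
    (simp_all add: multilinear_outer linear_add[OF linear_multilinear] matrix_vector_mul_assoc)

text \<open>This turns entries of a compressed tensor into inner products, the form in which
  orthogonality of the residual can be applied.\<close>

lemma multilinear_transpose_nth:
  "multilinear (transpose S) (transpose T) (transpose U) Y $ p $ q $ r
    = Y \<bullet> outer (column p S) (column q T) (column r U)"
  by (simp add: multilinear_def inner_tensor transpose_def column_def mult_ac)

section \<open>Cyclic permutation of the modes\<close>

text \<open>Results are proved for mode 1 and carried to the other two modes by rotating once or
  twice.\<close>

definition rot :: "('i::finite, 'j::finite, 'k::finite) tensor \<Rightarrow> ('j, 'k, 'i) tensor" where
  "rot Y = (\<chi> j k i. Y $ i $ j $ k)"

lemma rot_nth [simp]: "rot Y $ j $ k $ i = Y $ i $ j $ k"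
  by (simp add: rot_def)

lemma rot_add: "rot (X + Y) = rot X + rot Y"
  and rot_diff: "rot (X - Y) = rot X - rot Y"
  and rot_scaleR: "rot (t *\<^sub>R X) = t *\<^sub>R rot X"
  and rot_outer [simp]: "rot (outer a b c) = outer b c a"
  and rot_rot_rot [simp]: "rot (rot (rot Y)) = Y"
  by (simp_all add: tensor_eq_iff)

lemma rot_inject [simp]: "rot X = rot Y \<longleftrightarrow> X = Y"
  by (auto simp: tensor_eq_iff)

lemma inner_rot [simp]: "rot X \<bullet> rot Y = X \<bullet> Y"
proof -
  have "rot X \<bullet> rot Y = (\<Sum>j\<in>UNIV. \<Sum>i\<in>UNIV. \<Sum>k\<in>UNIV. X $ i $ j $ k * Y $ i $ j $ k)"
    by (simp add: inner_tensor) (rule sum.cong[OF refl], rule sum.swap)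
  also have "\<dots> = X \<bullet> Y"
    by (simp add: inner_tensor) (rule sum.swap)
  finally show ?thesis .
qed

lemma inner_rot_outer: "rot X \<bullet> outer b c a = X \<bullet> outer a b c"
  using inner_rot[of X "outer a b c"] by simp

lemma linear_rot: "linear rot"
  by (rule linearI) (simp_all add: rot_add rot_scaleR)

lemma fibers_rot [simp]: "fibers1 (rot Y) = fibers2 Y" "fibers2 (rot Y) = fibers3 Y"
  by (auto simp: fibers1_def fibers2_def fibers3_def)

section \<open>Rank at most two\<close>

lemma tensor_rank_le_iff:
  "tensor_rank Y \<le> R \<longleftrightarrow> (\<exists>a b c. Y = (\<Sum>r<R. outer (a r) (b r) (c r)))"
proof
  assume "tensor_rank Y \<le> R"
  then obtain n a b c where n: "n \<le> R" and Y: "Y = (\<Sum>r<n. outer (a r) (b r) (c r))"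
    using tensor_rank_decomposition by blast
  \<comment> \<open>A short decomposition is padded with zero terms; one vanishing factor per term
    is enough.\<close>
  let ?a = "\<lambda>r. if r < n then a r else 0"
  have "(\<Sum>r<R. outer (?a r) (b r) (c r)) = (\<Sum>r<n. outer (?a r) (b r) (c r))"
    using n by (intro sum.mono_neutral_right) auto
  then have "Y = (\<Sum>r<R. outer (?a r) (b r) (c r))"
    by (simp add: Y)
  then show "\<exists>a b c. Y = (\<Sum>r<R. outer (a r) (b r) (c r))"
    by (intro exI[of _ ?a] exI[of _ b] exI[of _ c])
next
  assume "\<exists>a b c. Y = (\<Sum>r<R. outer (a r) (b r) (c r))"
  then show "tensor_rank Y \<le> R"
    unfolding tensor_rank_def by (rule Least_le)
qed

lemma tensor_rank_outer_le: "tensor_rank (outer a b c) \<le> 1"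
  unfolding tensor_rank_le_iff
  by (intro exI[of _ "\<lambda>_. a"] exI[of _ "\<lambda>_. b"] exI[of _ "\<lambda>_. c"]) simp

lemma tensor_rank_le2_iff:
  "tensor_rank Y \<le> 2 \<longleftrightarrow> (\<exists>a0 b0 c0 a1 b1 c1. Y = outer a0 b0 c0 + outer a1 b1 c1)"
proof
  assume "tensor_rank Y \<le> 2"
  then show "\<exists>a0 b0 c0 a1 b1 c1. Y = outer a0 b0 c0 + outer a1 b1 c1"
    unfolding tensor_rank_le_iff by (simp add: numeral_2_eq_2) blast
next
  assume "\<exists>a0 b0 c0 a1 b1 c1. Y = outer a0 b0 c0 + outer a1 b1 c1"
  then obtain a0 b0 c0 a1 b1 c1 where Y: "Y = outer a0 b0 c0 + outer a1 b1 c1"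
    by blast
  show "tensor_rank Y \<le> 2"
    unfolding tensor_rank_le_iff Y
    by (intro exI[of _ "\<lambda>r. if r = 0 then a0 else a1"] exI[of _ "\<lambda>r. if r = 0 then b0 else b1"]
        exI[of _ "\<lambda>r. if r = 0 then c0 else c1"]) (simp add: numeral_2_eq_2)
qed

lemma tensor_rank_multilinear_le: "tensor_rank (multilinear S T U Y) \<le> tensor_rank Y"
proof -
  obtain n a b c where n: "n = tensor_rank Y" "Y = (\<Sum>r<n. outer (a r) (b r) (c r))"
    using tensor_rank_decomposition by blast
  then have "multilinear S T U Y = (\<Sum>r<n. outer (S *v a r) (T *v b r) (U *v c r))"
    by (simp add: linear_sum[OF linear_multilinear] multilinear_outer)
  then show ?thesis
    unfolding n(1)[symmetric] tensor_rank_le_iff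
    by (intro exI[of _ "\<lambda>r. S *v a r"] exI[of _ "\<lambda>r. T *v b r"] exI[of _ "\<lambda>r. U *v c r"])
qed

lemma tensor_rank_rot [simp]: "tensor_rank (rot Y) = tensor_rank Y"
proof -
  have le: "tensor_rank (rot W) \<le> tensor_rank W"
    for W :: "('x::finite, 'y::finite, 'z::finite) tensor"
  proof -
    obtain a b c where "W = (\<Sum>r<tensor_rank W. outer (a r) (b r) (c r))"
      using tensor_rank_decomposition by blast
    then have "rot W = rot (\<Sum>r<tensor_rank W. outer (a r) (b r) (c r))"
      by (rule arg_cong)
    then have "rot W = (\<Sum>r<tensor_rank W. outer (b r) (c r) (a r))"
      by (simp add: linear_sum[OF linear_rot])
    then show ?thesis
      unfolding tensor_rank_le_iff by blast
  qed
  \<comment> \<open>Three rotations give the identity, so the chain of inequalities closes into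
    equalities.\<close>
  show ?thesis
    using le[of Y] le[of "rot Y"] le[of "rot (rot Y)"] by simp
qed

text \<open>Collinearity with 0 encodes linear dependence, zero vectors included. Unless a factor
  vanishes, the second term has multiples of \<open>a0\<close> and \<open>b0\<close> as its first
  two factors, so the two terms merge by adding their third factors.\<close>

lemma tensor_rank_le1_if_collinear:
  assumes X: "X = outer a0 b0 c0 + outer a1 b1 c1"
    and a: "collinear {0, a0, a1}" and b: "collinear {0, b0, b1}"
  shows "tensor_rank X \<le> 1"
proof (cases "a0 = 0 \<or> a1 = 0 \<or> b0 = 0 \<or> b1 = 0")
  case True
  then have "X = outer a1 b1 c1 \<or> X = outer a0 b0 c0"
    unfolding X by auto
  then show ?thesis
    using tensor_rank_outer_le by blast
next
  case False
  then obtain s t where "a1 = s *\<^sub>R a0" "b1 = t *\<^sub>R b0"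
    using a b by (auto simp: collinear_lemma)
  then have "X = outer a0 b0 (c0 + (s * t) *\<^sub>R c1)"
    unfolding X by (simp add: outer_linear)
  then show ?thesis
    using tensor_rank_outer_le by metis
qed

text \<open>If the factors were dependent in a second mode as well, the two terms would merge into
  one. A vanishing first factor would also leave a single term.\<close>

lemma not_collinear_if_rank2:
  assumes X: "X = outer a0 b0 c0 + outer a1 b1 c1" and "tensor_rank X = 2"
    and a: "collinear {0, a0, a1}"
  shows "\<not> collinear {0, b0, b1}" and "\<not> collinear {0, c0, c1}"
    and "a0 \<noteq> 0" and "\<exists>s. s \<noteq> 0 \<and> a1 = s *\<^sub>R a0"
proof -
  show "\<not> collinear {0, b0, b1}"
    using tensor_rank_le1_if_collinear[OF X a] assms(2) by auto
  have "rot (rot X) = outer c0 a0 b0 + outer c1 a1 b1"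
    by (simp add: X rot_add)
  from tensor_rank_le1_if_collinear[OF this _ a] show "\<not> collinear {0, c0, c1}"
    using assms(2) by auto
  have "a0 \<noteq> 0" "a1 \<noteq> 0"
    using tensor_rank_outer_le[of a1 b1 c1] tensor_rank_outer_le[of a0 b0 c0] assms(2)
    by (auto simp: X)
  with a show "a0 \<noteq> 0" "\<exists>s. s \<noteq> 0 \<and> a1 = s *\<^sub>R a0"
    by (auto simp: collinear_lemma)
qed

section \<open>Orthogonality of the residual\<close>

text \<open>\<open>E\<close> stands for the residual \<open>Z - X\<close>. All decompositions of
  \<open>X\<close> are quantified over because a degenerate mode makes them non-unique, and the
  extra ones are exploited in \<open>critical_mixed\<close>. Conditions on the first term suffice,
  since the terms can be exchanged.\<close>

definition critical :: "('i::finite, 'j::finite, 'k::finite) tensor \<Rightarrow> ('i, 'j, 'k) tensor \<Rightarrow> bool"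
  where "critical E X \<longleftrightarrow> (\<forall>a0 b0 c0 a1 b1 c1. X = outer a0 b0 c0 + outer a1 b1 c1 \<longrightarrow>
    (\<forall>h. E \<bullet> outer h b0 c0 = 0) \<and> (\<forall>h. E \<bullet> outer a0 h c0 = 0) \<and> (\<forall>h. E \<bullet> outer a0 b0 h = 0))"

lemma criticalD:
  assumes "critical E X" and X: "X = outer a0 b0 c0 + outer a1 b1 c1"
  shows "E \<bullet> outer h b0 c0 = 0" "E \<bullet> outer a0 h' c0 = 0" "E \<bullet> outer a0 b0 h'' = 0"
    "E \<bullet> outer h b1 c1 = 0" "E \<bullet> outer a1 h' c1 = 0" "E \<bullet> outer a1 b1 h'' = 0"
proof -
  have X': "X = outer a1 b1 c1 + outer a0 b0 c0"
    using X by (simp add: add.commute)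
  show "E \<bullet> outer h b0 c0 = 0" "E \<bullet> outer a0 h' c0 = 0" "E \<bullet> outer a0 b0 h'' = 0"
    using assms unfolding critical_def by blast+
  show "E \<bullet> outer h b1 c1 = 0" "E \<bullet> outer a1 h' c1 = 0" "E \<bullet> outer a1 b1 h'' = 0"
    using assms(1) X' unfolding critical_def by blast+
qed

lemma critical_rot:
  assumes "critical E X"
  shows "critical (rot E) (rot X)"
  unfolding critical_def
proof (intro allI impI)
  fix a0 b0 c0 a1 b1 c1
  assume "rot X = outer a0 b0 c0 + outer a1 b1 c1"
  then have "rot X = rot (outer c0 a0 b0 + outer c1 a1 b1)"
    by (simp add: rot_add)
  then have "X = outer c0 a0 b0 + outer c1 a1 b1"
    by simp
  from criticalD[OF assms this]
  show "(\<forall>h. rot E \<bullet> outer h b0 c0 = 0) \<and> (\<forall>h. rot E \<bullet> outer a0 h c0 = 0)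
      \<and> (\<forall>h. rot E \<bullet> outer a0 b0 h = 0)"
    by (simp add: inner_rot_outer)
qed

text \<open>The whole line through \<open>X\<close> in direction \<open>V\<close> lies in
  \<open>W\<close>, so the squared distance along it is a quadratic polynomial in \<open>t\<close>
  with a local minimum at 0, and its linear coefficient vanishes.\<close>

lemma local_minimizer_inner_eq_0:
  fixes Z X V :: "'a::real_inner"
  assumes "local_minimizer (\<lambda>Y. (norm (Z - Y))\<^sup>2) W X" and V: "\<And>t. X + t *\<^sub>R V \<in> W"
  shows "(Z - X) \<bullet> V = 0"
proof -
  let ?f = "\<lambda>t. (norm (Z - (X + t *\<^sub>R V)))\<^sup>2"
  have "\<forall>\<^sub>F Y in at X within W. (norm (Z - X))\<^sup>2 \<le> (norm (Z - Y))\<^sup>2"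
    using assms(1) by (simp add: local_minimizer_def)
  then obtain d where d: "d > 0"
    "\<And>Y. Y \<in> W \<Longrightarrow> Y \<noteq> X \<Longrightarrow> dist Y X < d \<Longrightarrow> (norm (Z - X))\<^sup>2 \<le> (norm (Z - Y))\<^sup>2"
    unfolding eventually_at by blast
  have f: "?f t = (norm (Z - X))\<^sup>2 - 2 * t * ((Z - X) \<bullet> V) + t\<^sup>2 * (V \<bullet> V)" for t
    unfolding power2_norm_eq_inner by (simp add: algebra_simps inner_commute power2_eq_square)
  have "DERIV ?f 0 :> - 2 * ((Z - X) \<bullet> V)"
    unfolding f by (auto intro!: derivative_eq_intros)
  \<comment> \<open>The summand 1 keeps the denominator positive when \<open>V = 0\<close>.\<close>
  moreover have "0 < d / (norm V + 1)"
    using d(1) by (simp add: add_nonneg_pos)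
  moreover have "\<forall>t. \<bar>0 - t\<bar> < d / (norm V + 1) \<longrightarrow> ?f 0 \<le> ?f t"
  proof (intro allI impI)
    fix t :: real
    assume "\<bar>0 - t\<bar> < d / (norm V + 1)"
    then have "\<bar>t\<bar> * (norm V + 1) < d"
      by (simp add: pos_less_divide_eq add_nonneg_pos)
    then have "\<bar>t\<bar> * norm V < d"
      by (simp add: algebra_simps)
    \<comment> \<open>The punctured neighbourhood says nothing about \<open>X\<close> itself, so
      \<open>t *\<^sub>R V = 0\<close> is a separate, trivial case.\<close>
    then show "?f 0 \<le> ?f t"
      using d(2)[OF V[of t]] by (cases "t *\<^sub>R V = 0") (auto simp: dist_norm)
  qed
  ultimately have "- 2 * ((Z - X) \<bullet> V) = 0"
    by (rule DERIV_local_min)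
  then show ?thesis by simp
qed

lemma local_minimizer_subset:
  assumes "local_minimizer f W x" and "V \<subseteq> W" and "x \<in> V"
  shows "local_minimizer f V x"
  using assms by (auto simp: local_minimizer_def elim: filter_leD[OF at_le])

text \<open>An outer product is linear in each factor, so changing one factor of the first term
  moves \<open>X\<close> along a line inside the rank-two set.\<close>

lemma critical_if_locally_best:
  assumes "locally_best_approximation Z (rank_le_set 2) X"
  shows "critical (Z - X) X"
  unfolding critical_def
proof (intro allI impI)
  fix a0 b0 c0 a1 b1 c1
  assume X: "X = outer a0 b0 c0 + outer a1 b1 c1"
  have *: "(Z - X) \<bullet> V = 0" if V: "\<And>t. \<exists>a b c. outer a0 b0 c0 + t *\<^sub>R V = outer a b c" for V
  proof (rule local_minimizer_inner_eq_0)
    show "local_minimizer (\<lambda>Y. (norm (Z - Y))\<^sup>2) (rank_le_set 2) X"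
      using assms by (simp add: locally_best_approximation_def)
    fix t
    obtain a b c where "outer a0 b0 c0 + t *\<^sub>R V = outer a b c"
      using V by blast
    then have "X + t *\<^sub>R V = outer a b c + outer a1 b1 c1"
      by (simp add: X algebra_simps)
    then show "X + t *\<^sub>R V \<in> rank_le_set 2"
      unfolding rank_le_set_def tensor_rank_le2_iff by blast
  qed
  have "outer a0 b0 c0 + t *\<^sub>R outer h b0 c0 = outer (a0 + t *\<^sub>R h) b0 c0"
    and "outer a0 b0 c0 + t *\<^sub>R outer a0 h' c0 = outer a0 (b0 + t *\<^sub>R h') c0"
    and "outer a0 b0 c0 + t *\<^sub>R outer a0 b0 h'' = outer a0 b0 (c0 + t *\<^sub>R h'')" for t h h' h''
    by (simp_all add: outer_linear)
  then show "(\<forall>h. (Z - X) \<bullet> outer h b0 c0 = 0) \<and> (\<forall>h. (Z - X) \<bullet> outer a0 h c0 = 0)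
      \<and> (\<forall>h. (Z - X) \<bullet> outer a0 b0 h = 0)"
    using * by blast
qed

section \<open>Planes containing the factors\<close>

lemma span_pairE:
  assumes "x \<in> span {a, b}"
  obtains s t where "x = s *\<^sub>R a + t *\<^sub>R b"
proof -
  obtain s where "x - s *\<^sub>R a \<in> span {b}"
    using assms by (auto simp: span_breakdown_eq[of x a])
  then obtain t where "x - s *\<^sub>R a = t *\<^sub>R b"
    by (auto simp: span_singleton)
  then show thesis
    using that[of s t] by (simp add: algebra_simps)
qed

lemma dim_span_pair_le: "dim (span {a, b}) \<le> 2"
proof -
  have "dim (span {a, b}) \<le> card {a, b}"
    by (intro dim_le_card) auto
  also have "\<dots> \<le> 2"
    by (simp add: card_insert_if)
  finally show ?thesis .
qed

lemma span_not_collinear: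
  fixes V :: "'a::euclidean_space set"
  assumes "\<not> collinear {0, a, b}" and V: "subspace V" "dim V \<le> 2" "a \<in> V" "b \<in> V" and "x \<in> V"
  obtains s t where "x = s *\<^sub>R a + t *\<^sub>R b"
proof -
  have ne: "a \<noteq> 0" "b \<noteq> 0" "a \<noteq> b"
    using assms(1) by (auto simp: collinear_lemma dest: spec[of _ 1])
  have "b \<notin> span {a}"
    using assms(1) by (auto simp: collinear_lemma span_singleton)
  then have "independent {b, a}"
    using ne by (simp add: independent_insert)
  then have "V \<subseteq> span {b, a}"
    using V ne by (intro card_ge_dim_independent) auto
  then have "x \<in> span {a, b}"
    using \<open>x \<in> V\<close> by (auto simp: insert_commute)
  then show thesis
    using that by (rule span_pairE)
qed

text \<open>For a repeated first factor the decomposition is not unique: a shear of the other two factors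
  gives another one, and criticality for all of them yields the mixed products \<open>b0, c1\<close>.\<close>

lemma critical_mixed:
  assumes E: "critical E X" and X: "X = outer a0 b0 c0 + outer a1 b1 c1" and a: "a1 = s *\<^sub>R a0" and "s \<noteq> 0"
  shows "E \<bullet> outer h b0 c1 = 0"
proof -
  have "X = outer a0 b0 (c0 - s *\<^sub>R c1) + outer a1 (b1 + b0) c1"
    unfolding X a by (simp add: tensor_eq_iff algebra_simps)
  from criticalD(1)[OF E this, of h] criticalD(1)[OF E X, of h]
  have "E \<bullet> outer h b0 (c0 - s *\<^sub>R c1) = 0" "E \<bullet> outer h b0 c0 = 0" .
  moreover have "outer h b0 c0 = outer h b0 (c0 - s *\<^sub>R c1) + s *\<^sub>R outer h b0 c1"
    by (simp add: tensor_eq_iff algebra_simps)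
  ultimately show ?thesis
    using \<open>s \<noteq> 0\<close> by (simp add: inner_add_right)
qed

text \<open>The other two modes are independent here, so \<open>y\<close> and \<open>z\<close>
  expand in the factors. Products with equal indices vanish by criticality, the two mixed ones by
  \<open>critical_mixed\<close> for the decomposition and for its swap. The vector \<open>x\<close>
  is arbitrary.\<close>

lemma critical_collinear:
  assumes E: "critical E X" and X: "X = outer a0 b0 c0 + outer a1 b1 c1" and r: "tensor_rank X = 2"
    and a: "collinear {0, a0, a1}"
    and V2: "subspace V2" "dim V2 \<le> 2" "b0 \<in> V2" "b1 \<in> V2" "y \<in> V2"
    and V3: "subspace V3" "dim V3 \<le> 2" "c0 \<in> V3" "c1 \<in> V3" "z \<in> V3"
  shows "E \<bullet> outer x y z = 0"
proof -
  obtain s where s: "s \<noteq> 0" "a1 = s *\<^sub>R a0"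
    using not_collinear_if_rank2(4)[OF X r a] by blast
  have X': "X = outer a1 b1 c1 + outer a0 b0 c0"
    using X by (simp add: add.commute)
  have s': "inverse s \<noteq> 0" "a0 = inverse s *\<^sub>R a1"
    using s by simp_all
  obtain p q where y: "y = p *\<^sub>R b0 + q *\<^sub>R b1"
    using span_not_collinear[OF not_collinear_if_rank2(1)[OF X r a] V2] .
  obtain p' q' where z: "z = p' *\<^sub>R c0 + q' *\<^sub>R c1"
    using span_not_collinear[OF not_collinear_if_rank2(2)[OF X r a] V3] .
  show ?thesis
    using criticalD(1,4)[OF E X, of x] critical_mixed[OF E X s(2,1), of x]
      critical_mixed[OF E X' s'(2,1), of x]
    by (simp add: y z outer_linear inner_add_right)
qed

text \<open>If all modes are independent, expansion gives eight products of factors, and in each of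
  them two of the three indices agree. A dependent mode is rotated into first position. Subspaces
  are used instead of spans of factors, because in a dependent mode the plane is larger than the
  span.\<close>

lemma critical_orthogonal:
  assumes E: "critical E X" and X: "X = outer a0 b0 c0 + outer a1 b1 c1" and r: "tensor_rank X = 2"
    and V1: "subspace V1" "dim V1 \<le> 2" "a0 \<in> V1" "a1 \<in> V1" "x \<in> V1"
    and V2: "subspace V2" "dim V2 \<le> 2" "b0 \<in> V2" "b1 \<in> V2" "y \<in> V2"
    and V3: "subspace V3" "dim V3 \<le> 2" "c0 \<in> V3" "c1 \<in> V3" "z \<in> V3"
  shows "E \<bullet> outer x y z = 0"
proof -
  have X1: "rot X = outer b0 c0 a0 + outer b1 c1 a1"
    and X2: "rot (rot X) = outer c0 a0 b0 + outer c1 a1 b1"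
    by (simp_all add: X rot_add)
  consider "collinear {0, a0, a1}" | "collinear {0, b0, b1}" | "collinear {0, c0, c1}"
    | "\<not> collinear {0, a0, a1}" "\<not> collinear {0, b0, b1}" "\<not> collinear {0, c0, c1}"
    by argo
  then show ?thesis
  proof cases
    case 1
    then show ?thesis by (rule critical_collinear[OF E X r _ V2 V3])
  next
    case 2
    then have "rot E \<bullet> outer y z x = 0"
      using critical_collinear[OF critical_rot[OF E] X1 _ _ V3 V1] r by simp
    then show ?thesis by (simp add: inner_rot_outer)
  next
    case 3
    then have "rot (rot E) \<bullet> outer z x y = 0"
      using critical_collinear[OF critical_rot[OF critical_rot[OF E]] X2 _ _ V1 V2] r by simp
    then show ?thesis by (simp add: inner_rot_outer)
  next
    case 4
    obtain p q where x: "x = p *\<^sub>R a0 + q *\<^sub>R a1"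
      using span_not_collinear[OF 4(1) V1] .
    obtain p' q' where y: "y = p' *\<^sub>R b0 + q' *\<^sub>R b1"
      using span_not_collinear[OF 4(2) V2] .
    obtain p'' q'' where z: "z = p'' *\<^sub>R c0 + q'' *\<^sub>R c1"
      using span_not_collinear[OF 4(3) V3] .
    show ?thesis
      using criticalD[OF E X] by (simp add: x y z outer_linear inner_add_right)
  qed
qed

section \<open>Stationarity\<close>

text \<open>Orthonormal bases \<open>B\<close> of the span and \<open>C\<close> of its orthogonal
  complement together form an orthonormal basis of the space. It remains to number it so that
  \<open>B\<close> occupies positions among \<open>l0\<close> and \<open>l1\<close>.\<close>

lemma orthogonal_matrix_span_columns:
  fixes a b :: "real ^ 'n" and l0 l1 :: 'n
  assumes "l0 \<noteq> l1"
  obtains Q :: "real ^ 'n ^ 'n" where "orthogonal_matrix Q"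
    and "a \<in> span {column l0 Q, column l1 Q}" "b \<in> span {column l0 Q, column l1 Q}"
proof -
  let ?V = "span {a, b}" and ?W = "{y. \<forall>x\<in>span {a, b}. orthogonal x y}"
  obtain B where B: "B \<subseteq> ?V" "pairwise orthogonal B" "\<And>x. x \<in> B \<Longrightarrow> norm x = 1"
      "independent B" "card B = dim ?V" "span B = ?V"
    using orthonormal_basis_subspace[OF subspace_span] by blast
  obtain C where C: "C \<subseteq> ?W" "pairwise orthogonal C" "\<And>x. x \<in> C \<Longrightarrow> norm x = 1"
      "independent C" "card C = dim ?W" "span C = ?W"
    using orthonormal_basis_subspace[OF subspace_orthogonal_to_vectors] by blast
  have fin: "finite B" "finite C"
    using B(4) C(4) independent_imp_finite by blast+
  have BC: "orthogonal x y" "orthogonal y x" if "x \<in> B" "y \<in> C" for x y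
  proof -
    show "orthogonal x y"
      using B(1) C(1) that by blast
    then show "orthogonal y x"
      by (simp add: orthogonal_commute)
  qed
  have disj: "B \<inter> C = {}"
    using BC B(3) by (fastforce simp: orthogonal_def norm_eq_1)
  have "dim ?V + dim ?W = CARD('n)"
    using dim_subspace_orthogonal_to_vectors[of ?V UNIV] by (simp add: add.commute orthogonal_commute)
  then have card: "card (B \<union> C) = CARD('n)"
    using fin disj by (simp add: card_Un_disjoint B(5) C(5))
  \<comment> \<open>The span may have dimension below two. Then \<open>g\<close> misses some of
    \<open>l0\<close>, \<open>l1\<close>, and those positions are filled from \<open>C\<close>
    through \<open>g'\<close>.\<close>
  have "card B \<le> card {l0, l1}"
    using assms B(5) dim_span_pair_le[of a b] by simp
  then obtain g where g: "inj_on g B" "g ` B \<subseteq> {l0, l1}"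
    using card_le_inj[OF fin(1), of "{l0, l1}"] by auto
  have "card (UNIV - g ` B) = card C"
    using card fin disj g(1) by (simp add: card_Diff_subset card_Un_disjoint card_image)
  then obtain g' where g': "bij_betw g' C (UNIV - g ` B)"
    using finite_same_card_bij[of C "UNIV - g ` B"] fin by auto
  define h where "h x = (if x \<in> B then g x else g' x)" for x
  have hB: "bij_betw h B (g ` B)"
    using g(1) by (auto simp: bij_betw_def h_def inj_on_def)
  have "bij_betw h C (UNIV - g ` B)"
    using g' disj by (subst bij_betw_cong[of _ _ g']) (auto simp: h_def)
  then have h: "bij_betw h (B \<union> C) UNIV"
    using bij_betw_combine[OF hB, of C "UNIV - g ` B"] by simp
  define u where "u = inv_into (B \<union> C) h"
  have u: "bij_betw u UNIV (B \<union> C)"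
    unfolding u_def by (rule bij_betw_inv_into[OF h])
  define Q :: "real ^ 'n ^ 'n" where "Q = (\<chi> i j. u j $ i)"
  have col: "column j Q = u j" for j
    by (simp add: column_def Q_def vec_eq_iff)
  have norm1: "norm x = 1" if "x \<in> B \<union> C" for x
    using B(3) C(3) that by blast
  have orth: "orthogonal x y" if "x \<in> B \<union> C" "y \<in> B \<union> C" "x \<noteq> y" for x y
    using that B(2) C(2) BC by (auto simp: pairwise_def)
  have "orthogonal_matrix Q"
    unfolding orthogonal_matrix_orthonormal_columns col
  proof (intro conjI allI impI)
    show "norm (u i) = 1" for i
      using u norm1 by (auto simp: bij_betw_def)
    show "orthogonal (u i) (u j)" if "i \<noteq> j" for i j
      using u that by (intro orth) (auto simp: bij_betw_def inj_on_def)
  qed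
  moreover have "B \<subseteq> {u l0, u l1}"
  proof
    fix x
    assume "x \<in> B"
    then have "u (h x) = x"
      unfolding u_def using h by (simp add: bij_betw_inv_into_left)
    moreover have "h x \<in> {l0, l1}"
      using \<open>x \<in> B\<close> g(2) by (auto simp: h_def)
    ultimately show "x \<in> {u l0, u l1}" by auto
  qed
  then have "?V \<subseteq> span {u l0, u l1}"
    using span_mono B(6) by metis
  then have "a \<in> span {u l0, u l1}" "b \<in> span {u l0, u l1}"
    using span_superset[of "{a, b}"] by auto
  ultimately show thesis
    using that by (simp add: col)
qed

lemma orthogonal_matrix_inner_columns:
  fixes Q :: "real ^ 'n ^ 'n"
  assumes "orthogonal_matrix Q"
  shows "column i Q \<bullet> column j Q = (if i = j then 1 else 0)"
  using assms by (auto simp: orthogonal_matrix_orthonormal_columns orthogonal_def norm_eq_1)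

lemma UNIV_2_01: "(UNIV :: 2 set) = {0, 1}"
  using UNIV_2 by (auto simp: insert_commute)

lemma range_lead: "range lead = {lead 0, lead 1 :: 'i::{finite, linorder}}"
  by (simp add: UNIV_2_01)

lemma lead_neq:
  assumes "CARD('i::{finite, linorder}) \<ge> 2"
  shows "(lead 0 :: 'i) \<noteq> lead 1"
  using lead_initial(1)[OF assms] by simp

text \<open>All claims follow from orthonormality of the columns. The expansion feeds
  \<open>first_order_condition\<close>, the projection identity recovers \<open>X\<close> from its
  core, and the third claim makes the factors of \<open>X\<close> orthogonal to the remaining
  columns.\<close>

lemma lead_columns:
  fixes Q :: "((real, 'i) vec, 'i::{finite, linorder}) vec"
  assumes card: "CARD('i) \<ge> 2" and Q: "orthogonal_matrix Q"
    and x: "x \<in> span {column (lead 0) Q, column (lead 1) Q}"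
  shows "(\<Sum>q\<in>range lead. (x \<bullet> column q Q) *\<^sub>R column q Q) = x"
    and "first_two_columns Q *v (transpose (first_two_columns Q) *v x) = x"
    and "i \<notin> range lead \<Longrightarrow> x \<bullet> column i Q = 0"
    and "dim (span {column (lead 0) Q, column (lead 1) Q}) \<le> 2"
proof -
  let ?u = "\<lambda>j. column j Q"
  note uu = orthogonal_matrix_inner_columns[OF Q]
  note ne = lead_neq[OF card]
  obtain s t where st: "x = s *\<^sub>R ?u (lead 0) + t *\<^sub>R ?u (lead 1)"
    using x by (rule span_pairE)
  show *: "(\<Sum>q\<in>range lead. (x \<bullet> ?u q) *\<^sub>R ?u q) = x"
    using ne by (simp add: range_lead st inner_add_left uu)
  show "x \<bullet> ?u i = 0" if "i \<notin> range lead"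
    using that by (auto simp: range_lead st inner_add_left uu)
  show "dim (span {?u (lead 0), ?u (lead 1)}) \<le> 2"
    by (rule dim_span_pair_le)
  have "(first_two_columns Q *v (transpose (first_two_columns Q) *v x)) $ m
      = (\<Sum>q\<in>range lead. (x \<bullet> ?u q) *\<^sub>R ?u q) $ m" for m
  proof -
    \<comment> \<open>Injectivity of \<open>lead\<close> turns the sum over the type
      \<open>2\<close> into a sum over \<open>range lead\<close>.\<close>
    have inj: "inj (lead :: 2 \<Rightarrow> 'i)"
      using ne by (auto simp: inj_on_def UNIV_2_01)
    have "(first_two_columns Q *v (transpose (first_two_columns Q) *v x)) $ m
      = (\<Sum>p\<in>UNIV. Q $ m $ lead p * (x \<bullet> ?u (lead p)))"
      by (simp del: transpose_matrix_vector add: matrix_vector_mult_def first_two_columns_def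
          transpose_def inner_vec_def column_def mult.commute)
    also have "\<dots> = (\<Sum>q\<in>range lead. Q $ m $ q * (x \<bullet> ?u q))"
      using inj by (simp add: sum.reindex)
    finally show ?thesis by (simp add: column_def mult.commute)
  qed
  then show "first_two_columns Q *v (transpose (first_two_columns Q) *v x) = x"
    by (simp only: * vec_eq_iff) simp
qed

text \<open>The mode-1 slices of \<open>X\<close> lie in the span of \<open>b0 \<circ> c0\<close> and \<open>b1 \<circ> c1\<close>, so the sum
  is a combination of the two numbers \<open>Z \<bullet> (s' \<circ> bm \<circ> cm)\<close>.\<close>

lemma first_order_condition:
  assumes E: "critical (Z - X) X" and X: "X = outer a0 b0 c0 + outer a1 b1 c1"
    and t: "(\<Sum>q\<in>Q. (b0 \<bullet> t q) *\<^sub>R t q) = b0" "(\<Sum>q\<in>Q. (b1 \<bullet> t q) *\<^sub>R t q) = b1"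
    and u: "(\<Sum>r\<in>R. (c0 \<bullet> u r) *\<^sub>R u r) = c0" "(\<Sum>r\<in>R. (c1 \<bullet> u r) *\<^sub>R u r) = c1"
    and s': "a0 \<bullet> s' = 0" "a1 \<bullet> s' = 0"
    and ZX: "\<And>q r. q \<in> Q \<Longrightarrow> r \<in> R \<Longrightarrow> (Z - X) \<bullet> outer s (t q) (u r) = 0"
  shows "(\<Sum>q\<in>Q. \<Sum>r\<in>R. (Z \<bullet> outer s (t q) (u r)) * (Z \<bullet> outer s' (t q) (u r))) = 0"
proof -
  have *: "(\<Sum>q\<in>Q. \<Sum>r\<in>R. (b \<bullet> t q) * (c \<bullet> u r) * (Z \<bullet> outer s' (t q) (u r))) = 0"
    if "(\<Sum>q\<in>Q. (b \<bullet> t q) *\<^sub>R t q) = b" "(\<Sum>r\<in>R. (c \<bullet> u r) *\<^sub>R u r) = c"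
      "(Z - X) \<bullet> outer s' b c = 0" for b c
  proof -
    have "Z \<bullet> outer s' b c = X \<bullet> outer s' b c"
      using that(3) by (simp add: inner_diff_left)
    also have "\<dots> = 0"
      using s' by (simp add: X inner_add_left inner_outer_outer)
    finally have "Z \<bullet> outer s' (\<Sum>q\<in>Q. (b \<bullet> t q) *\<^sub>R t q) (\<Sum>r\<in>R. (c \<bullet> u r) *\<^sub>R u r) = 0"
      using that by simp
    then show ?thesis
      by (subst sum.swap)
        (simp add: outer_sum2 outer_sum3 outer_linear inner_sum_right sum_distrib_left mult_ac)
  qed
  have Zs: "Z \<bullet> outer s (t q) (u r)
      = (a0 \<bullet> s) * ((b0 \<bullet> t q) * (c0 \<bullet> u r)) + (a1 \<bullet> s) * ((b1 \<bullet> t q) * (c1 \<bullet> u r))"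
    if "q \<in> Q" "r \<in> R" for q r
    using ZX[OF that] by (simp add: inner_diff_left X inner_add_left inner_outer_outer)
  have "(\<Sum>q\<in>Q. \<Sum>r\<in>R. (Z \<bullet> outer s (t q) (u r)) * (Z \<bullet> outer s' (t q) (u r)))
    = (\<Sum>q\<in>Q. \<Sum>r\<in>R. (a0 \<bullet> s) * ((b0 \<bullet> t q) * (c0 \<bullet> u r) * (Z \<bullet> outer s' (t q) (u r)))
       + (a1 \<bullet> s) * ((b1 \<bullet> t q) * (c1 \<bullet> u r) * (Z \<bullet> outer s' (t q) (u r))))"
    by (intro sum.cong refl) (simp add: Zs algebra_simps)
  also have "\<dots> = 0"
    using *[OF t(1) u(1)] *[OF t(2) u(2)] criticalD[OF E X]
    by (simp add: sum.distrib flip: sum_distrib_left)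
  finally show ?thesis .
qed

text \<open>The leading columns are chosen so that their spans contain the factors. The residual is
  then orthogonal to all products of leading columns, so \<open>Z\<close> and \<open>X\<close> have
  the same core, and projecting onto these spans leaves \<open>X\<close> unchanged. The conditions
  for modes 2 and 3 come from the rotated tensors.\<close>

lemma stationary_if_critical:
  fixes Z X :: "('i::{finite, linorder}, 'j::{finite, linorder}, 'k::{finite, linorder}) tensor"
  assumes card: "CARD('i) \<ge> 2" "CARD('j) \<ge> 2" "CARD('k) \<ge> 2"
    and E: "critical (Z - X) X" and r: "tensor_rank X = 2"
  shows "stationary_point_222 Z X"
proof -
  obtain a0 b0 c0 a1 b1 c1 where X: "X = outer a0 b0 c0 + outer a1 b1 c1"
    using r tensor_rank_le2_iff[of X] by auto
  obtain S :: "((real, 'i) vec, 'i) vec" where S: "orthogonal_matrix S"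
    and a: "a0 \<in> span {column (lead 0) S, column (lead 1) S}" "a1 \<in> span {column (lead 0) S, column (lead 1) S}"
    using orthogonal_matrix_span_columns[OF lead_neq[OF card(1)]] .
  obtain T :: "((real, 'j) vec, 'j) vec" where T: "orthogonal_matrix T"
    and b: "b0 \<in> span {column (lead 0) T, column (lead 1) T}" "b1 \<in> span {column (lead 0) T, column (lead 1) T}"
    using orthogonal_matrix_span_columns[OF lead_neq[OF card(2)]] .
  obtain U :: "((real, 'k) vec, 'k) vec" where U: "orthogonal_matrix U"
    and c: "c0 \<in> span {column (lead 0) U, column (lead 1) U}" "c1 \<in> span {column (lead 0) U, column (lead 1) U}"
    using orthogonal_matrix_span_columns[OF lead_neq[OF card(3)]] .
  note lS = lead_columns[OF card(1) S] and lT = lead_columns[OF card(2) T]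
    and lU = lead_columns[OF card(3) U]
  have mem: "column p Q \<in> span {column (lead 0) Q, column (lead 1) Q}" if "p \<in> range lead"
    for p and Q :: "((real, 'n) vec, 'n::{finite, linorder}) vec"
    using that by (auto simp: range_lead intro: span_base)
  have ZX: "(Z - X) \<bullet> outer (column p S) (column q T) (column r U) = 0"
    if "p \<in> range lead" "q \<in> range lead" "r \<in> range lead" for p q r
    by (rule critical_orthogonal[OF E X \<open>tensor_rank X = 2\<close> subspace_span lS(4)[OF a(1)] a mem[OF that(1)]
        subspace_span lT(4)[OF b(1)] b mem[OF that(2)] subspace_span lU(4)[OF c(1)] c mem[OF that(3)]])
  let ?S = "first_two_columns S" and ?T = "first_two_columns T" and ?U = "first_two_columns U"
  have col: "column p (first_two_columns Q) = column (lead p) Q" for p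
    and Q :: "real ^ 'n::{finite, linorder} ^ 'm"
    by (simp add: column_def first_two_columns_def)
  have "multilinear (transpose ?S) (transpose ?T) (transpose ?U) Z
      = multilinear (transpose ?S) (transpose ?T) (transpose ?U) X"
    using ZX by (simp add: tensor_eq_iff multilinear_transpose_nth col inner_diff_left)
  moreover have "multilinear ?S ?T ?U (multilinear (transpose ?S) (transpose ?T) (transpose ?U) X) = X"
    using a b c lS(2) lT(2) lU(2)
    by (simp add: X linear_add[OF linear_multilinear] multilinear_outer)
  ultimately have XG: "X = multilinear ?S ?T ?U
      (multilinear (transpose ?S) (transpose ?T) (transpose ?U) Z)"
    by simp
  have X1: "rot X = outer b0 c0 a0 + outer b1 c1 a1"
    and X2: "rot (rot X) = outer c0 a0 b0 + outer c1 a1 b1"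
    by (simp_all add: X rot_add)
  have E1: "critical (rot Z - rot X) (rot X)"
    using critical_rot[OF E] by (simp add: rot_diff)
  have E2: "critical (rot (rot Z) - rot (rot X)) (rot (rot X))"
    using critical_rot[OF E1] by (simp add: rot_diff)
  note inner_rot_outer [simp] and rot_diff [symmetric, simp]
  have "(\<Sum>q\<in>range lead. \<Sum>r\<in>range lead. (Z \<bullet> outer (column p S) (column q T) (column r U))
        * (Z \<bullet> outer (column i S) (column q T) (column r U))) = 0"
    if "p \<in> range lead" "i \<notin> range lead" for p i
    using that ZX by (intro first_order_condition[OF E X]
        lS(3)[OF a(1)] lS(3)[OF a(2)] lT(1) lU(1) b c) auto
  moreover have "(\<Sum>p\<in>range lead. \<Sum>r\<in>range lead. (Z \<bullet> outer (column p S) (column q T) (column r U))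
        * (Z \<bullet> outer (column p S) (column j T) (column r U))) = 0"
    if "q \<in> range lead" "j \<notin> range lead" for q j
  proof -
    have "(\<Sum>r\<in>range lead. \<Sum>p\<in>range lead. (rot Z \<bullet> outer (column q T) (column r U) (column p S))
        * (rot Z \<bullet> outer (column j T) (column r U) (column p S))) = 0"
      using that ZX by (intro first_order_condition[OF E1 X1]
          lT(3)[OF b(1)] lT(3)[OF b(2)] lU(1) lS(1) a c) auto
    \<comment> \<open>The rotated condition sums over mode 3 before mode 1, hence the exchange of
      sums.\<close>
    then show ?thesis
      by simp (subst sum.swap, simp)
  qed
  moreover have "(\<Sum>p\<in>range lead. \<Sum>q\<in>range lead. (Z \<bullet> outer (column p S) (column q T) (column r U))
        * (Z \<bullet> outer (column p S) (column q T) (column k U))) = 0"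
    if "r \<in> range lead" "k \<notin> range lead" for r k
  proof -
    have "(\<Sum>p\<in>range lead. \<Sum>q\<in>range lead. (rot (rot Z) \<bullet> outer (column r U) (column p S) (column q T))
        * (rot (rot Z) \<bullet> outer (column k U) (column p S) (column q T))) = 0"
      using that ZX by (intro first_order_condition[OF E2 X2]
          lU(3)[OF c(1)] lU(3)[OF c(2)] lS(1) lT(1) a b) auto
    then show ?thesis by simp
  qed
  ultimately show ?thesis
    unfolding stationary_point_222_def Let_def multilinear_transpose_nth
    using S T U XG by blast
qed

section \<open>Interior points\<close>

text \<open>The discriminant of the binary quadratic form \<open>(x, y) \<mapsto> det (x G1 + y G2)\<close>, where
  \<open>G1, G2\<close> are the slices.\<close>

definition hyperdet :: "(2, 2, 2) tensor \<Rightarrow> real" where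
  "hyperdet Y =
     (Y$1$1$1 * Y$2$2$2 + Y$2$1$1 * Y$1$2$2 - Y$1$1$2 * Y$2$2$1 - Y$2$1$2 * Y$1$2$1)\<^sup>2
     - 4 * (Y$1$1$1 * Y$1$2$2 - Y$1$1$2 * Y$1$2$1) * (Y$2$1$1 * Y$2$2$2 - Y$2$1$2 * Y$2$2$1)"

definition det2 :: "real ^ 2 \<Rightarrow> real ^ 2 \<Rightarrow> real" where
  "det2 u v = u$1 * v$2 - u$2 * v$1"

lemma collinear_if_det2_eq_0:
  assumes "det2 u v = 0"
  shows "collinear {0, u, v}"
proof (cases "u = 0")
  case False
  then consider "u$1 \<noteq> 0" | "u$2 \<noteq> 0"
    by (auto simp: vec_eq_iff forall_2)
  then have "\<exists>c. v = c *\<^sub>R u"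
  proof cases
    case 1
    then have "v = (v$1 / u$1) *\<^sub>R u"
      using assms by (simp add: vec_eq_iff forall_2 det2_def field_simps)
    then show ?thesis by blast
  next
    case 2
    then have "v = (v$2 / u$2) *\<^sub>R u"
      using assms by (simp add: vec_eq_iff forall_2 det2_def field_simps)
    then show ?thesis by blast
  qed
  then show ?thesis by (auto simp: collinear_lemma)
qed simp

text \<open>Cayley's hyperdeterminant does not depend on the mode along which the tensor is
  sliced.\<close>

lemma hyperdet_rot: "hyperdet (rot Y) = hyperdet Y"
  by (simp add: hyperdet_def) algebra

text \<open>The tensor is the image of the unit diagonal tensor, whose hyperdeterminant is 1, under
  the matrices with columns \<open>a0, a1\<close>, \<open>b0, b1\<close> and \<open>c0, c1\<close>.
  Each matrix contributes the square of its determinant.\<close>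

lemma hyperdet_outer_add:
  "hyperdet (outer a0 b0 c0 + outer a1 b1 c1) = (det2 a0 a1 * det2 b0 b1 * det2 c0 c1)\<^sup>2"
  by (simp add: hyperdet_def det2_def) algebra

lemma hyperdet_nonneg_if_rank_le2:
  assumes "tensor_rank Y \<le> 2"
  shows "0 \<le> hyperdet Y"
  using assms by (auto simp: tensor_rank_le2_iff hyperdet_outer_add)

text \<open>With \<open>l = (a$1, a$2)\<close> and \<open>l' = (- a$2, a$1)\<close> read as linear forms in \<open>(x, y)\<close>, the form
  of this tensor is \<open>s (l\<^sup>2 + t\<^sup>2 l'\<^sup>2)\<close> times a constant, hence definite.\<close>

lemma hyperdet_perturbation:
  fixes a b0 b1 c0 c1 :: "real ^ 2"
  defines "p \<equiv> (\<chi> i. if i = 1 then - (a$2) else a$1)"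
  shows "hyperdet (outer a b0 c0 + outer (s *\<^sub>R a) b1 c1 + t *\<^sub>R (outer p b0 c1 - s *\<^sub>R outer p b1 c0))
    = - 4 * (s * t * (a \<bullet> a) * det2 b0 b1 * det2 c0 c1)\<^sup>2"
proof -
  let ?D = "det2 b0 b1 * det2 c0 c1"
  let ?Y = "outer a b0 c0 + outer (s *\<^sub>R a) b1 c1 + t *\<^sub>R (outer p b0 c1 - s *\<^sub>R outer p b1 c0)"
  have p: "p $ 1 = - (a$2)" "p $ 2 = a$1"
    by (simp_all add: p_def)
  have 1: "?Y$1$1$1 * ?Y$1$2$2 - ?Y$1$1$2 * ?Y$1$2$1 = s * ((a$1)\<^sup>2 + t\<^sup>2 * (a$2)\<^sup>2) * ?D"
    by (simp add: p det2_def) algebra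
  have 2: "?Y$2$1$1 * ?Y$2$2$2 - ?Y$2$1$2 * ?Y$2$2$1 = s * ((a$2)\<^sup>2 + t\<^sup>2 * (a$1)\<^sup>2) * ?D"
    by (simp add: p det2_def) algebra
  have 3: "?Y$1$1$1 * ?Y$2$2$2 + ?Y$2$1$1 * ?Y$1$2$2 - ?Y$1$1$2 * ?Y$2$2$1 - ?Y$2$1$2 * ?Y$1$2$1
      = 2 * s * (a$1) * (a$2) * (1 - t\<^sup>2) * ?D"
    by (simp add: p det2_def) algebra
  have 4: "a \<bullet> a = (a$1)\<^sup>2 + (a$2)\<^sup>2"
    by (simp add: inner_vec_def sum_2 power2_eq_square)
  show ?thesis
    unfolding hyperdet_def 1 2 3 4 by algebra
qed

text \<open>If \<open>a0\<close> and \<open>a1\<close> were dependent, the direction of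
  \<open>hyperdet_perturbation\<close> would lead to negative values for every nonzero
  \<open>t\<close>. Assuming nonnegativity along lines, rather than interiority, makes the
  hypothesis easy to rotate.\<close>

lemma not_collinear_if_hyperdet_nonneg:
  fixes H :: "(2, 2, 2) tensor"
  assumes H: "H = outer a0 b0 c0 + outer a1 b1 c1" and r: "tensor_rank H = 2"
    and nonneg: "\<And>E. \<forall>\<^sub>F t in at 0. 0 \<le> hyperdet (H + t *\<^sub>R E)"
  shows "\<not> collinear {0, a0, a1}"
proof
  assume a: "collinear {0, a0, a1}"
  note nc = not_collinear_if_rank2[OF H r a]
  obtain s where s: "s \<noteq> 0" "a1 = s *\<^sub>R a0"
    using nc(4) by blast
  define p :: "real ^ 2" where "p = (\<chi> i. if i = 1 then - (a0$2) else a0$1)"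
  \<comment> \<open>At \<open>t = 0\<close> the hyperdeterminant is zero and gives no contradiction,
    so a nonzero \<open>t\<close> must be secured.\<close>
  have "\<forall>\<^sub>F t in at 0. 0 \<le> hyperdet (H + t *\<^sub>R (outer p b0 c1 - s *\<^sub>R outer p b1 c0)) \<and> t \<noteq> 0"
    by (intro eventually_conj nonneg eventually_neq_at_within)
  then obtain t where "t \<noteq> 0" "0 \<le> hyperdet (H + t *\<^sub>R (outer p b0 c1 - s *\<^sub>R outer p b1 c0))"
    using eventually_happens[of _ "at (0::real)"] by auto
  then have "0 \<le> - 4 * (s * t * (a0 \<bullet> a0) * det2 b0 b1 * det2 c0 c1)\<^sup>2"
    unfolding H s(2) p_def hyperdet_perturbation by simp
  moreover have "s * t * (a0 \<bullet> a0) * det2 b0 b1 * det2 c0 c1 \<noteq> 0"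
    using nc(1,2,3) s(1) \<open>t \<noteq> 0\<close> collinear_if_det2_eq_0 by auto
  ultimately show False
    by (metis mult_minus_left neg_0_le_iff_le not_le zero_less_mult_iff zero_less_numeral zero_less_power2)
qed

text \<open>Along every line through \<open>H\<close> the rank stays at most two for small
  \<open>t\<close>, so the hyperdeterminant stays nonnegative there. Cyclic symmetry extends the
  conclusion to all modes.\<close>

lemma not_collinear_if_interior:
  fixes H :: "(2, 2, 2) tensor"
  assumes H: "H = outer a0 b0 c0 + outer a1 b1 c1" and r: "tensor_rank H = 2"
    and int: "H \<in> interior (rank_le_set 2)"
  shows "\<not> collinear {0, a0, a1}" "\<not> collinear {0, b0, b1}" "\<not> collinear {0, c0, c1}"
proof -
  have nonneg: "\<forall>\<^sub>F t in at 0. 0 \<le> hyperdet (H + t *\<^sub>R E)" for E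
  proof -
    have "((\<lambda>t. H + t *\<^sub>R E) \<longlongrightarrow> H + 0 *\<^sub>R E) (at 0)"
      by (intro tendsto_intros)
    then have "\<forall>\<^sub>F t in at 0. H + t *\<^sub>R E \<in> interior (rank_le_set 2)"
      using int by (intro topological_tendstoD) auto
    then show ?thesis
      by eventually_elim
        (use interior_subset hyperdet_nonneg_if_rank_le2 in \<open>auto simp: rank_le_set_def\<close>)
  qed
  have nonneg_rot: "\<forall>\<^sub>F t in at 0. 0 \<le> hyperdet (rot W + t *\<^sub>R E)"
    if "\<And>E. \<forall>\<^sub>F t in at 0. 0 \<le> hyperdet (W + t *\<^sub>R E)" for W E :: "(2, 2, 2) tensor"
  proof -
    \<comment> \<open>Two rotations invert one, so \<open>rot (rot E)\<close> is the direction that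
      \<open>rot\<close> maps to \<open>E\<close>.\<close>
    have "hyperdet (rot W + t *\<^sub>R E) = hyperdet (W + t *\<^sub>R rot (rot E))" for t
      using hyperdet_rot[of "W + t *\<^sub>R rot (rot E)"] by (simp add: rot_add rot_scaleR)
    then show ?thesis using that by simp
  qed
  show "\<not> collinear {0, a0, a1}"
    by (rule not_collinear_if_hyperdet_nonneg[OF H r nonneg])
  have H1: "rot H = outer b0 c0 a0 + outer b1 c1 a1"
    by (simp add: H rot_add)
  show "\<not> collinear {0, b0, b1}"
    by (rule not_collinear_if_hyperdet_nonneg[OF H1 _ nonneg_rot[OF nonneg]]) (simp add: r)
  have H2: "rot (rot H) = outer c0 a0 b0 + outer c1 a1 b1"
    by (simp add: H rot_add)
  show "\<not> collinear {0, c0, c1}"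
    by (rule not_collinear_if_hyperdet_nonneg[OF H2 _ nonneg_rot[OF nonneg_rot[OF nonneg]]])
      (simp add: r)
qed

section \<open>Recovery of a tensor from its compression\<close>

lemma dual_pair:
  fixes b0 b1 :: "'a::real_inner"
  assumes "\<not> collinear {0, b0, b1}"
  obtains y0 y1 where "b0 \<bullet> y0 = 1" "b1 \<bullet> y0 = 0" "b0 \<bullet> y1 = 0" "b1 \<bullet> y1 = 1"
proof -
  have *: "\<exists>y. u \<bullet> y = 1 \<and> v \<bullet> y = 0" if nc: "\<not> collinear {0, v, u}" for u v :: 'a
  proof -
    have "v \<noteq> 0" using nc by (auto simp: collinear_lemma)
    \<comment> \<open>This is the component of \<open>u\<close> orthogonal to \<open>v\<close>;
      rescaling it makes its product with \<open>u\<close> equal to 1.\<close>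
    define y where "y = u - ((u \<bullet> v) / (v \<bullet> v)) *\<^sub>R v"
    have "y \<noteq> 0" using nc by (auto simp: collinear_lemma y_def)
    have "v \<bullet> y = 0"
      using \<open>v \<noteq> 0\<close> by (simp add: y_def inner_diff_right inner_commute)
    then have "u \<bullet> y = y \<bullet> y"
      by (simp add: y_def[THEN arg_cong[of _ _ "\<lambda>x. x \<bullet> y"]] inner_diff_left)
    then show ?thesis
      using \<open>y \<noteq> 0\<close> \<open>v \<bullet> y = 0\<close> by (intro exI[of _ "inverse (y \<bullet> y) *\<^sub>R y"]) simp
  qed
  show thesis
    using *[of b1 b0] *[of b0 b1] assms that by (auto simp: insert_commute)
qed

text \<open>Pairing modes 2 and 3 with fixed vectors selects a vector that lies in the mode-1 fiber
  span of every \<open>Y\<close> and depends linearly, hence continuously, on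
  \<open>Y\<close>.\<close>

definition contract :: "('i::finite, 'j::finite, 'k::finite) tensor \<Rightarrow> real ^ 'j \<Rightarrow> real ^ 'k \<Rightarrow> real ^ 'i"
  where "contract Y y z = (\<Sum>j\<in>UNIV. \<Sum>k\<in>UNIV. (y $ j * z $ k) *\<^sub>R (\<chi> i. Y $ i $ j $ k))"

lemma contract_in_span: "contract Y y z \<in> span (fibers1 Y)"
  unfolding contract_def by (intro span_sum span_scale span_base) (auto simp: fibers1_def)

lemma linear_contract: "linear (\<lambda>Y. contract Y y z)"
  by (rule linearI)
    (simp_all add: contract_def vec_eq_iff algebra_simps sum.distrib sum_distrib_left)

lemma contract_outer: "contract (outer a b c) y z = ((b \<bullet> y) * (c \<bullet> z)) *\<^sub>R a"
proof -
  have "contract (outer a b c) y z $ i = (b \<bullet> y) * (c \<bullet> z) * a $ i" for i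
  proof -
    have "contract (outer a b c) y z $ i
        = (\<Sum>j\<in>UNIV. \<Sum>k\<in>UNIV. (b $ j * y $ j) * (c $ k * z $ k) * a $ i)"
      by (simp add: contract_def mult_ac)
    also have "\<dots> = (b \<bullet> y) * (c \<bullet> z) * a $ i"
      by (simp add: inner_vec_def flip: sum_distrib_left sum_distrib_right)
    finally show ?thesis .
  qed
  then show ?thesis by (simp add: vec_eq_iff)
qed

lemma linear_tendsto_nhds:
  fixes f :: "'a::euclidean_space \<Rightarrow> 'b::real_normed_vector"
  assumes "linear f"
  shows "(f \<longlongrightarrow> f x) (nhds x)"
  using linear_continuous_at[of f x] assms
  by (simp add: linear_conv_bounded_linear isCont_def tendsto_at_iff_tendsto_nhds)

lemma not_collinear_matrix_vector_mult:
  fixes M :: "real ^ 'n ^ 'm"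
  assumes "\<not> collinear {0, M *v x, M *v y}"
  shows "\<not> collinear {0, x, y}"
  using assms by (auto simp: collinear_lemma matrix_vector_mult_scaleR)

text \<open>Near \<open>X\<close> the matrix \<open>transpose S\<close> stays injective on the span of the mode-1 fibers, since it
  separates two contractions which at \<open>X\<close> are \<open>a0\<close> and \<open>a1\<close>.\<close>

lemma eventually_fibers1_recovered:
  fixes X :: "('i::finite, 'j::finite, 'k::finite) tensor" and S :: "real ^ 2 ^ 'i"
  assumes X: "X = outer a0 b0 c0 + outer a1 b1 c1"
    and a: "\<not> collinear {0, transpose S *v a0, transpose S *v a1}"
    and b: "\<not> collinear {0, b0, b1}" and c: "\<not> collinear {0, c0, c1}"
  shows "\<forall>\<^sub>F Y in nhds X. dim (span (fibers1 Y)) \<le> 2 \<longrightarrow>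
    (\<exists>A :: real ^ 2 ^ 'i. \<forall>v\<in>fibers1 Y. (A ** transpose S) *v v = v)"
proof -
  obtain y0 y1 where y: "b0 \<bullet> y0 = 1" "b1 \<bullet> y0 = 0" "b0 \<bullet> y1 = 0" "b1 \<bullet> y1 = 1"
    using dual_pair[OF b] .
  obtain z0 z1 where z: "c0 \<bullet> z0 = 1" "c1 \<bullet> z0 = 0" "c0 \<bullet> z1 = 0" "c1 \<bullet> z1 = 1"
    using dual_pair[OF c] .
  define w0 where "w0 Y = transpose S *v contract Y y0 z0" for Y :: "('i, 'j, 'k) tensor"
  define w1 where "w1 Y = transpose S *v contract Y y1 z1" for Y :: "('i, 'j, 'k) tensor"
  have "contract X y0 z0 = a0" "contract X y1 z1 = a1"
    using y z by (simp_all add: X linear_add[OF linear_contract] contract_outer)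
  then have "det2 (w0 X) (w1 X) \<noteq> 0"
    using a collinear_if_det2_eq_0 unfolding w0_def w1_def by auto
  moreover have "(w0 \<longlongrightarrow> w0 X) (nhds X)" "(w1 \<longlongrightarrow> w1 X) (nhds X)"
    unfolding w0_def w1_def
    by (intro linear_tendsto_nhds linear_compose[OF linear_contract, unfolded o_def]
        matrix_vector_mul_linear)+
  then have "((\<lambda>Y. det2 (w0 Y) (w1 Y)) \<longlongrightarrow> det2 (w0 X) (w1 X)) (nhds X)"
    unfolding det2_def by (intro tendsto_intros)
  ultimately have "\<forall>\<^sub>F Y in nhds X. det2 (w0 Y) (w1 Y) \<noteq> 0"
    by (rule tendsto_imp_eventually_ne[rotated])
  then show ?thesis
  proof (eventually_elim, intro impI)
    fix Y :: "('i, 'j, 'k) tensor"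
    assume g: "det2 (w0 Y) (w1 Y) \<noteq> 0" and dim: "dim (span (fibers1 Y)) \<le> 2"
    define v0 where "v0 = contract Y y0 z0"
    define v1 where "v1 = contract Y y1 z1"
    have w: "w0 Y = transpose S *v v0" "w1 Y = transpose S *v v1"
      by (simp_all add: w0_def w1_def v0_def v1_def)
    have nc: "\<not> collinear {0, v0, v1}"
    proof
      assume "collinear {0, v0, v1}"
      then have "det2 (w0 Y) (w1 Y) = 0"
        unfolding w by (auto simp del: transpose_matrix_vector
            simp: collinear_lemma matrix_vector_mult_scaleR det2_def)
      with g show False by blast
    qed
    \<comment> \<open>By Cramer's rule \<open>f\<close> sends \<open>w0 Y\<close> to
      \<open>v0\<close> and \<open>w1 Y\<close> to \<open>v1\<close>, so it undoes
      \<open>transpose S\<close> on the span of \<open>v0\<close> and \<open>v1\<close>, which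
      contains all fibers by the dimension bound.\<close>
    define f where "f x = (det2 x (w1 Y) / det2 (w0 Y) (w1 Y)) *\<^sub>R v0
      + (det2 (w0 Y) x / det2 (w0 Y) (w1 Y)) *\<^sub>R v1" for x
    have lin: "linear f"
      by (rule linearI) (simp_all add: f_def det2_def algebra_simps add_divide_distrib diff_divide_distrib)
    have mf: "matrix f *v x = f x" for x
      using fun_cong[OF matrix_vector_mul(2)[OF lin]] .
    have f: "f (w0 Y) = v0" "f (w1 Y) = v1"
      using g by (simp_all add: f_def) (simp_all add: det2_def)
    have "(matrix f ** transpose S) *v v = v" if v: "v \<in> fibers1 Y" for v
    proof -
      obtain s t where st: "v = s *\<^sub>R v0 + t *\<^sub>R v1"
        using span_not_collinear[OF nc subspace_span dim _ _ span_base[OF v]] contract_in_span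
        unfolding v0_def v1_def by blast
      have "(matrix f ** transpose S) *v v = f (s *\<^sub>R w0 Y + t *\<^sub>R w1 Y)"
        by (simp del: transpose_matrix_vector flip: matrix_vector_mul_assoc
            add: mf linear_add[OF lin] linear_scale[OF lin] st w matrix_vector_right_distrib matrix_vector_mult_scaleR)
      then show ?thesis
        by (simp add: linear_add[OF lin] linear_scale[OF lin] f st)
    qed
    then show "\<exists>A :: real ^ 2 ^ 'i. \<forall>v\<in>fibers1 Y. (A ** transpose S) *v v = v"
      by blast
  qed
qed

lemma rot_multilinear: "rot (multilinear A B C Y) = multilinear B C A (rot Y)"
  by (induction Y rule: tensor_induct)
    (simp_all add: multilinear_outer rot_add linear_add[OF linear_multilinear])

lemma multilinear_fibers1:
  assumes "\<And>v. v \<in> fibers1 Y \<Longrightarrow> M *v v = v"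
  shows "multilinear M (mat 1) (mat 1) Y = Y"
proof -
  have "multilinear M (mat 1) (mat 1) Y $ i $ j $ k = Y $ i $ j $ k" for i j k
  proof -
    have "multilinear M (mat 1) (mat 1) Y $ i $ j $ k = (\<Sum>p\<in>UNIV. \<Sum>q\<in>UNIV. \<Sum>r\<in>UNIV.
        if r = k then if q = j then M $ i $ p * Y $ p $ q $ r else 0 else 0)"
      unfolding multilinear_def vec_lambda_beta by (intro sum.cong refl) (auto simp: mat_def)
    also have "\<dots> = (M *v (\<chi> i. Y $ i $ j $ k)) $ i"
      by (simp add: matrix_vector_mult_def)
    finally have "multilinear M (mat 1) (mat 1) Y $ i $ j $ k = (M *v (\<chi> i. Y $ i $ j $ k)) $ i" .
    moreover have "(\<chi> i. Y $ i $ j $ k) \<in> fibers1 Y"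
      unfolding fibers1_def by blast
    ultimately show ?thesis
      by (simp add: assms)
  qed
  then show ?thesis by (simp add: tensor_eq_iff)
qed

text \<open>The map factors into three maps acting in one mode each, and each of them fixes
  \<open>Y\<close>.\<close>

lemma multilinear_fibers:
  assumes "\<And>v. v \<in> fibers1 Y \<Longrightarrow> A *v v = v" "\<And>v. v \<in> fibers2 Y \<Longrightarrow> B *v v = v"
    "\<And>v. v \<in> fibers3 Y \<Longrightarrow> C *v v = v"
  shows "multilinear A B C Y = Y"
proof -
  have "rot (multilinear (mat 1) B (mat 1) Y) = rot Y"
    unfolding rot_multilinear using assms(2) by (intro multilinear_fibers1) simp
  moreover have "rot (rot (multilinear (mat 1) (mat 1) C Y)) = rot (rot Y)"
    unfolding rot_multilinear using assms(3) by (intro multilinear_fibers1) simp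
  ultimately have "multilinear A (mat 1) (mat 1) (multilinear (mat 1) B (mat 1)
      (multilinear (mat 1) (mat 1) C Y)) = Y"
    using multilinear_fibers1[of Y A] assms(1) by simp
  then show ?thesis
    by (simp add: multilinear_multilinear)
qed

lemma dim_fibers1_le2:
  assumes "Y = outer a0 b0 c0 + outer a1 b1 c1"
  shows "dim (span (fibers1 Y)) \<le> 2"
proof -
  have "fibers1 Y \<subseteq> span {a0, a1}"
  proof
    fix v
    assume "v \<in> fibers1 Y"
    then obtain j k where "v = (b0 $ j * c0 $ k) *\<^sub>R a0 + (b1 $ j * c1 $ k) *\<^sub>R a1"
      by (auto simp: fibers1_def assms vec_eq_iff mult_ac)
    then show "v \<in> span {a0, a1}"
      by (simp add: span_add span_scale span_base)
  qed
  then have "dim (span (fibers1 Y)) \<le> dim (span {a0, a1})"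
    by (intro dim_subset span_minimal) auto
  then show ?thesis
    using dim_span_pair_le[of a0 a1] by linarith
qed

lemma mrank_le_222_iff:
  "Y \<in> mrank_le_set (2, 2, 2) \<longleftrightarrow> dim (span (fibers1 Y)) \<le> 2
    \<and> dim (span (fibers1 (rot Y))) \<le> 2 \<and> dim (span (fibers1 (rot (rot Y)))) \<le> 2"
  by (simp add: mrank_le_set_def mrank_def)

lemma mrank_le_222_if_rank_le2:
  assumes "tensor_rank Y \<le> 2"
  shows "Y \<in> mrank_le_set (2, 2, 2)"
proof -
  have *: "dim (span (fibers1 W)) \<le> 2" if "tensor_rank W \<le> 2"
    for W :: "('x::finite, 'y::finite, 'z::finite) tensor"
    using that dim_fibers1_le2 unfolding tensor_rank_le2_iff by blast
  show ?thesis
    unfolding mrank_le_222_iff using assms *[of Y] *[of "rot Y"] *[of "rot (rot Y)"] by simp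
qed

lemma transpose_mult_columnwise_orthogonal:
  assumes "columnwise_orthogonal S"
  shows "transpose S ** S = mat 1"
  using assms
  by (simp add: columnwise_orthogonal_def vec_eq_iff matrix_matrix_mult_def transpose_def mat_def
      inner_vec_def column_def)

text \<open>Recovery in all three modes writes \<open>Y\<close> as a multilinear image of its
  compression. The compression depends continuously on \<open>Y\<close> and equals the interior core
  at \<open>X\<close>, so near \<open>X\<close> it has rank at most two, and multilinear maps do not
  raise rank.\<close>

lemma eventually_rank_le2_near_interior_point:
  fixes X :: "('i::finite, 'j::finite, 'k::finite) tensor"
  assumes r: "tensor_rank X = 2" and int: "interior_point_rank2 X"
  shows "\<forall>\<^sub>F Y in nhds X. Y \<in> mrank_le_set (2, 2, 2) \<longrightarrow> tensor_rank Y \<le> 2"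
proof -
  obtain S :: "real ^ 2 ^ 'i" and T :: "real ^ 2 ^ 'j" and U :: "real ^ 2 ^ 'k" and H
    where STU: "columnwise_orthogonal S" "columnwise_orthogonal T" "columnwise_orthogonal U"
      and XH: "X = multilinear S T U H" and H: "H \<in> interior (rank_le_set 2)"
    using int unfolding interior_point_rank2_def by blast
  note id = STU[THEN transpose_mult_columnwise_orthogonal]
  have "tensor_rank H \<le> 2"
    using H interior_subset by (auto simp: rank_le_set_def)
  then obtain a0 b0 c0 a1 b1 c1 where Hd: "H = outer a0 b0 c0 + outer a1 b1 c1"
    unfolding tensor_rank_le2_iff by blast
  have Xd: "X = outer (S *v a0) (T *v b0) (U *v c0) + outer (S *v a1) (T *v b1) (U *v c1)"
    by (simp add: XH Hd linear_add[OF linear_multilinear] multilinear_outer)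
  \<comment> \<open>A core of smaller rank would force smaller rank on \<open>X\<close>.\<close>
  have "tensor_rank H = 2"
    using \<open>tensor_rank H \<le> 2\<close> r tensor_rank_multilinear_le[of S T U H] XH by simp
  note nc = not_collinear_if_interior[OF Hd this H]
  have left_inv: "transpose S *v (S *v x) = x" "transpose T *v (T *v x) = x" "transpose U *v (U *v x) = x" for x
    by (simp_all add: matrix_vector_mul_assoc id del: transpose_matrix_vector)
  have nS: "\<not> collinear {0, transpose S *v (S *v a0), transpose S *v (S *v a1)}"
    and nT: "\<not> collinear {0, transpose T *v (T *v b0), transpose T *v (T *v b1)}"
    and nU: "\<not> collinear {0, transpose U *v (U *v c0), transpose U *v (U *v c1)}"
    using nc by (simp_all only: left_inv not_False_eq_True)
  note nS' = not_collinear_matrix_vector_mult[OF nS] and nT' = not_collinear_matrix_vector_mult[OF nT]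
    and nU' = not_collinear_matrix_vector_mult[OF nU]
  have X1: "rot X = outer (T *v b0) (U *v c0) (S *v a0) + outer (T *v b1) (U *v c1) (S *v a1)"
    and X2: "rot (rot X) = outer (U *v c0) (S *v a0) (T *v b0) + outer (U *v c1) (S *v a1) (T *v b1)"
    by (simp_all add: Xd rot_add)
  let ?P = "\<lambda>Y M. dim (span (fibers1 Y)) \<le> 2 \<longrightarrow> (\<exists>A. \<forall>v\<in>fibers1 Y. (A ** transpose M) *v v = v)"
  have rot: "(rot \<longlongrightarrow> rot W) (nhds W)" for W :: "('x::finite, 'y::finite, 'z::finite) tensor"
    by (rule linear_tendsto_nhds[OF linear_rot])
  have "\<forall>\<^sub>F Y in nhds X. ?P Y S"
    by (rule eventually_fibers1_recovered[OF Xd nS nT' nU'])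
  \<comment> \<open>Continuity of \<open>rot\<close> pulls neighbourhoods of the rotated tensors
    back to neighbourhoods of \<open>X\<close>.\<close>
  moreover have "\<forall>\<^sub>F Y in nhds X. ?P (rot Y) T"
    by (rule eventually_compose_filterlim[OF eventually_fibers1_recovered[OF X1 nT nU' nS'] rot])
  moreover have "\<forall>\<^sub>F Y in nhds X. ?P (rot (rot Y)) U"
    by (rule eventually_compose_filterlim[OF eventually_compose_filterlim[OF
        eventually_fibers1_recovered[OF X2 nU nS' nT'] rot] rot])
  moreover have "\<forall>\<^sub>F Y in nhds X.
      multilinear (transpose S) (transpose T) (transpose U) Y \<in> interior (rank_le_set 2)"
  proof -
    have "multilinear (transpose S) (transpose T) (transpose U) X = H"
      unfolding Xd Hd linear_add[OF linear_multilinear] multilinear_outer left_inv ..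
    then have "(multilinear (transpose S) (transpose T) (transpose U) \<longlongrightarrow> H) (nhds X)"
      using linear_tendsto_nhds[OF linear_multilinear] by metis
    then show ?thesis
      using H by (intro topological_tendstoD) auto
  qed
  ultimately show ?thesis
  proof eventually_elim
    case (elim Y)
    show ?case
    proof
      assume "Y \<in> mrank_le_set (2, 2, 2)"
      then obtain A B C where "\<And>v. v \<in> fibers1 Y \<Longrightarrow> (A ** transpose S) *v v = v"
        "\<And>v. v \<in> fibers1 (rot Y) \<Longrightarrow> (B ** transpose T) *v v = v"
        "\<And>v. v \<in> fibers1 (rot (rot Y)) \<Longrightarrow> (C ** transpose U) *v v = v"
        using elim(1-3) unfolding mrank_le_222_iff by blast
      then have "multilinear (A ** transpose S) (B ** transpose T) (C ** transpose U) Y = Y"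
        by (intro multilinear_fibers) simp_all
      then have "Y = multilinear A B C (multilinear (transpose S) (transpose T) (transpose U) Y)"
        by (simp add: multilinear_multilinear)
      moreover have "tensor_rank (multilinear (transpose S) (transpose T) (transpose U) Y) \<le> 2"
        using elim(4) interior_subset by (auto simp: rank_le_set_def)
      ultimately show "tensor_rank Y \<le> 2"
        using tensor_rank_multilinear_le order_trans by metis
    qed
  qed
qed

theorem theorem4p1:
  fixes Z X :: "('i::{finite, linorder}, 'j::{finite, linorder}, 'k::{finite, linorder}) tensor"
  assumes "CARD('i) \<ge> 2" and "CARD('j) \<ge> 2" and "CARD('k) \<ge> 2"
    and "tensor_rank Z > 2"
    and "locally_best_approximation Z (closure (rank_le_set 2)) X"
    and "tensor_rank X = 2"
  shows "stationary_point_222 Z X \<and>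
    (interior_point_rank2 X \<longrightarrow> locally_best_approximation Z (mrank_le_set (2, 2, 2)) X)"
proof (intro conjI impI)
  have "X \<in> rank_le_set 2"
    using assms(6) by (simp add: rank_le_set_def)
  \<comment> \<open>Minimality over the closure restricts to the rank-two set because
    \<open>X\<close> itself belongs to it.\<close>
  then have "locally_best_approximation Z (rank_le_set 2) X"
    using assms(5) local_minimizer_subset closure_subset
    unfolding locally_best_approximation_def by blast
  then show "stationary_point_222 Z X"
    by (intro stationary_if_critical critical_if_locally_best assms)
next
  assume "interior_point_rank2 X"
  \<comment> \<open>Near \<open>X\<close> every competitor of multilinear rank at most
    \<open>(2, 2, 2)\<close> is already a competitor in the closure, so local minimality carries
    over.\<close>
  from eventually_rank_le2_near_interior_point[OF assms(6) this]
  have "\<forall>\<^sub>F Y in nhds X. Y \<in> mrank_le_set (2, 2, 2) \<longrightarrow> Y \<in> closure (rank_le_set 2)"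
    by eventually_elim (auto intro!: subsetD[OF closure_subset] simp: rank_le_set_def)
  moreover have "\<forall>\<^sub>F Y in nhds X. Y \<noteq> X \<longrightarrow> Y \<in> closure (rank_le_set 2) \<longrightarrow>
      (norm (Z - X))\<^sup>2 \<le> (norm (Z - Y))\<^sup>2"
    using assms(5)
    by (simp add: locally_best_approximation_def local_minimizer_def eventually_at_filter)
  ultimately have "\<forall>\<^sub>F Y in nhds X. Y \<noteq> X \<longrightarrow> Y \<in> mrank_le_set (2, 2, 2) \<longrightarrow>
      (norm (Z - X))\<^sup>2 \<le> (norm (Z - Y))\<^sup>2"
    by eventually_elim blast
  then show "locally_best_approximation Z (mrank_le_set (2, 2, 2)) X"
    using mrank_le_222_if_rank_le2[of X] assms(6)
    by (simp add: locally_best_approximation_def local_minimizer_def eventually_at_filter)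
qed

end
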